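(* For every $n\ge 2$, the subgroup $\mathbf{O}_C$ of the $n\times n\times n$ Rubik's Cube group $\mathbf{G}$ consisting of the elements that leave every cubie in its position and fix every sticker not lying on a corner cubie (so that they only change corner orientations) is isomorphic to $\mathbb{Z}_3^7$.
   Context: The $n\times n\times n$ Rubik's Cube has faces U, D, F, B, R, L, each an $n\times n$ grid of facelets carrying stickers ($6n^2$ in total). For $1\le k\le\lfloor n/2\rfloor$, $F_k,B_k,R_k,L_k,U_k,D_k$ denote clockwise (seen from the named face) $90^\circ$ rotations of the $k$-th $n\times n\times 1$ slice counted from the named face. $\mathbf{G}$ is the subgroup of the symmetric group on the facelets generated by the facelet permutations induced by these moves. Corner cubies are the 8 cubies with three stickers; each can be rotated in place among 3 orientations (elements of $\mathbb{Z}_3$). *)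

theory Defs
  imports "HOL-Algebra.Bij" "HOL-Algebra.Product_Groups"
begin

text \<open>
  The cube is centred at the origin of a right-handed coordinate system whose axes point
  right, up and towards the viewer. Lengths are doubled, so that the centres of the cubies have
  the integer coordinates \<open>-(n-1), -(n-3), \<dots>, n-1\<close> and all rotations are linear.
\<close>

type_synonym vec = "int \<times> int \<times> int"

datatype face = Up | Down | Front | Back | Right | Left

fun outward :: "face \<Rightarrow> vec" where
  "outward Right = (1, 0, 0)"
| "outward Left = (-1, 0, 0)"
| "outward Up = (0, 1, 0)"
| "outward Down = (0, -1, 0)"
| "outward Front = (0, 0, 1)"
| "outward Back = (0, 0, -1)"

fun dot :: "vec \<Rightarrow> vec \<Rightarrow> int" where
  "dot (x, y, z) (x', y', z') = x * x' + y * y' + z * z'"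

text \<open>
  The quarter turn of space that is clockwise when seen from outside the given face. For example,
  turning \<open>Right\<close> takes the normal of \<open>Front\<close> to that of \<open>Up\<close>.
\<close>

fun turn :: "face \<Rightarrow> vec \<Rightarrow> vec" where
  "turn Right (x, y, z) = (x, z, -y)"
| "turn Left (x, y, z) = (x, -z, y)"
| "turn Up (x, y, z) = (-z, y, x)"
| "turn Down (x, y, z) = (z, y, -x)"
| "turn Front (x, y, z) = (y, -x, z)"
| "turn Back (x, y, z) = (-y, x, z)"

definition coords :: "nat \<Rightarrow> int set" where
  "coords n = (\<lambda>i. 2 * int i - (int n - 1)) ` {..<n}"

text \<open>
  A facelet is a pair of the position of its cubie and the outward normal of its face.
\<close>

type_synonym facelet = "vec \<times> vec"

definition facelets :: "nat \<Rightarrow> facelet set" where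
  "facelets n =
     {(p, d). p \<in> coords n \<times> coords n \<times> coords n \<and> d \<in> range outward \<and> dot p d = int n - 1}"

definition slice :: "nat \<Rightarrow> face \<Rightarrow> nat \<Rightarrow> vec set" where
  "slice n f k = {p. dot p (outward f) = int n - 1 - 2 * (int k - 1)}"

definition move :: "nat \<Rightarrow> face \<Rightarrow> nat \<Rightarrow> facelet \<Rightarrow> facelet" where
  "move n f k =
     (\<lambda>(p, d) \<in> facelets n. if p \<in> slice n f k then (turn f p, turn f d) else (p, d))"

definition rubik_group :: "nat \<Rightarrow> (facelet \<Rightarrow> facelet) monoid" where
  "rubik_group n =
     subgroup_generated (BijGroup (facelets n)) {move n f k | f k. 1 \<le> k \<and> k \<le> n div 2}"

definition corner :: "nat \<Rightarrow> vec \<Rightarrow> bool" where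
  "corner n p \<longleftrightarrow> card {x \<in> facelets n. fst x = p} = 3"

definition corner_orientations :: "nat \<Rightarrow> (facelet \<Rightarrow> facelet) set" where
  "corner_orientations n =
     {g \<in> carrier (rubik_group n).
        \<forall>x \<in> facelets n. fst (g x) = fst x \<and> (\<not> corner n (fst x) \<longrightarrow> g x = x)}"


lemma turn_inj: "turn f p = turn f q \<longleftrightarrow> p = q"
  by (cases f; cases p; cases q) auto

lemma dot_turn: "dot (turn f p) (turn f q) = dot p q"
  by (cases f; cases p; cases q) auto

lemma turn_outward: "turn f (outward f) = outward f"
  by (cases f) auto

lemma turn_range: "d \<in> range outward \<Longrightarrow> turn f d \<in> range outward"
proof -
  have "turn f (outward g) \<in>
      {outward Up, outward Down, outward Front, outward Back, outward Right, outward Left}" for g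
    by (cases f; cases g) simp_all
  then show "d \<in> range outward \<Longrightarrow> turn f d \<in> range outward"
    by blast
qed

lemma coords_uminus: "x \<in> coords n \<Longrightarrow> -x \<in> coords n"
proof -
  assume "x \<in> coords n"
  then obtain i where "i < n" "x = 2 * int i - (int n - 1)"
    by (auto simp: coords_def)
  then show ?thesis
    unfolding coords_def by (intro image_eqI[where x = "n - 1 - i"]) (auto simp: of_nat_diff)
qed

lemma turn_coords:
  "p \<in> coords n \<times> coords n \<times> coords n \<Longrightarrow> turn f p \<in> coords n \<times> coords n \<times> coords n"
  by (cases f; cases p) (auto intro: coords_uminus)

lemma finite_facelets: "finite (facelets n)"
proof (rule finite_subset)
  have "UNIV = {Up, Down, Front, Back, Right, Left}"
    using face.exhaust by auto
  then have "finite (UNIV :: face set)"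
    by (metis finite.emptyI finite.insertI)
  then show "finite ((coords n \<times> coords n \<times> coords n) \<times> range outward)"
    by (auto simp: coords_def)
qed (auto simp: facelets_def)

text \<open>
  \<^const>\<open>subgroup_generated\<close> silently drops generators outside the carrier; this does not
  happen for the moves.
\<close>

lemma move_in_carrier: "move n f k \<in> carrier (BijGroup (facelets n))"
proof -
  let ?S = "facelets n"
  have maps: "move n f k ` ?S \<subseteq> ?S"
    using turn_coords turn_range
    by (simp add: move_def facelets_def dot_turn image_subset_iff split_beta mem_Times_iff)
  have slice: "turn f p \<in> slice n f k \<longleftrightarrow> p \<in> slice n f k" for p
    using dot_turn[of f p "outward f"] by (simp add: turn_outward slice_def)
  have "inj_on (move n f k) ?S"
  proof (rule inj_onI)
    fix x y assume "x \<in> ?S" "y \<in> ?S" "move n f k x = move n f k y"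
    moreover obtain p d q e where "x = (p, d)" "y = (q, e)"
      by (cases x, cases y) blast
    ultimately show "x = y"
      using slice[of p] slice[of q] by (simp add: move_def turn_inj split: if_splits)
  qed
  then have "bij_betw (move n f k) ?S ?S"
    using maps by (simp add: bij_betw_def endo_inj_surj finite_facelets)
  then show ?thesis
    by (simp add: BijGroup_def Bij_def move_def)
qed

lemma group_rubik_group: "group (rubik_group n)"
  unfolding rubik_group_def by (rule group.group_subgroup_generated[OF group_BijGroup])

lemma subgroup_corner_orientations: "subgroup (corner_orientations n) (rubik_group n)"
proof -
  interpret B: group "BijGroup (facelets n)" by (rule group_BijGroup)
  interpret group "rubik_group n" by (rule group_rubik_group)
  have sub: "carrier (rubik_group n) \<subseteq> Bij (facelets n)"
    unfolding rubik_group_def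
    using B.carrier_subgroup_generated_subset by (auto simp: BijGroup_def)
  have mult: "(g \<otimes>\<^bsub>rubik_group n\<^esub> h) x = g (h x)"
    if "g \<in> carrier (rubik_group n)" "h \<in> carrier (rubik_group n)" "x \<in> facelets n" for g h x
  proof -
    have "g \<in> Bij (facelets n)" "h \<in> Bij (facelets n)" using that sub by blast+
    with \<open>x \<in> facelets n\<close> show ?thesis
      by (simp add: rubik_group_def BijGroup_def compose_eq)
  qed
  have one: "\<one>\<^bsub>rubik_group n\<^esub> x = x" if "x \<in> facelets n" for x
    using that by (simp add: rubik_group_def BijGroup_def)
  have maps: "g x \<in> facelets n" if "g \<in> carrier (rubik_group n)" "x \<in> facelets n" for g x
    using that sub Bij_imp_funcset by blast
  show ?thesis
  proof (rule subgroupI)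
    show "corner_orientations n \<subseteq> carrier (rubik_group n)"
      by (auto simp: corner_orientations_def)
    show "corner_orientations n \<noteq> {}"
      using one_closed by (auto simp: corner_orientations_def one intro!: exI[of _ "\<one>\<^bsub>rubik_group n\<^esub>"])
  next
    fix g assume "g \<in> corner_orientations n"
    then have g: "g \<in> carrier (rubik_group n)"
      and fx: "\<And>x. x \<in> facelets n \<Longrightarrow> fst (g x) = fst x \<and> (\<not> corner n (fst x) \<longrightarrow> g x = x)"
      by (auto simp: corner_orientations_def)
    let ?h = "inv\<^bsub>rubik_group n\<^esub> g"
    have h: "?h \<in> carrier (rubik_group n)" using g by simp
    have gh: "g (?h x) = x" if "x \<in> facelets n" for x
      using mult[OF g h that] g that by (simp add: one)
    have "fst (?h x) = fst x \<and> (\<not> corner n (fst x) \<longrightarrow> ?h x = x)" if "x \<in> facelets n" for x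
      using fx[OF maps[OF h that]] gh[OF that] by auto
    then show "?h \<in> corner_orientations n"
      using h by (simp add: corner_orientations_def)
  next
    fix g h assume "g \<in> corner_orientations n" "h \<in> corner_orientations n"
    then show "g \<otimes>\<^bsub>rubik_group n\<^esub> h \<in> corner_orientations n"
      using mult maps by (auto simp: corner_orientations_def)
  qed
qed

end

theory Submission
  imports Defs
begin

text \<open>
  Number the three stickers of every corner cubie by the elements of \<open>\<int>/3\<close> in
  counterclockwise order. Each element of the cube group permutes the corners and adds a constant \<open>t p\<close> to the
  numbers of the three stickers at \<open>p\<close>. The sum of all \<open>t p\<close> is a homomorphism to
  \<open>\<int>/3\<close> that vanishes on the moves, so a pure reorientation of the corners is determined by
  its twists at seven of them.

  Conversely, the commutator of \<open>(R' D' R D)\<^sup>2\<close> and \<open>U\<close>, formed with the outermost slices,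
  twists two adjacent corners in opposite directions and moves nothing else. Its rotated copies
  along a Hamiltonian path through the corners realise every choice of seven twists.
\<close>

section \<open>Corner cubies and the numbering of their stickers\<close>

definition corners :: "nat \<Rightarrow> vec set" where
  "corners n = {int n - 1, 1 - int n} \<times> {int n - 1, 1 - int n} \<times> {int n - 1, 1 - int n}"

fun chirality :: "vec \<Rightarrow> int" where
  "chirality (x, y, z) = sgn x * sgn y * sgn z"

fun axis :: "vec \<Rightarrow> int" where
  "axis (a, b, c) = b\<^sup>2 - c\<^sup>2"

text \<open>
  The residue modulo 3 numbers the stickers of a corner: the axes \<open>x\<close>, \<open>y\<close>, \<open>z\<close> have
  the numbers \<open>0\<close>, \<open>1\<close>, \<open>-1\<close>, and the sign of the octant makes the cyclic order
  rotation invariant.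
\<close>

definition orient :: "facelet \<Rightarrow> int" where
  "orient x = chirality (fst x) * axis (snd x)"

lemma range_outward:
  "range outward = {(1, 0, 0), (-1, 0, 0), (0, 1, 0), (0, -1, 0), (0, 0, 1), (0, 0, -1)}"
proof -
  have "UNIV = {Right, Left, Up, Down, Front, Back}"
    using face.exhaust by auto
  then show ?thesis
    by (metis image_insert image_empty outward.simps)
qed

lemma finite_corners: "finite (corners n)"
  by (simp add: corners_def)

lemma corners_subset_coords:
  assumes "n \<ge> 2"
  shows "corners n \<subseteq> coords n \<times> coords n \<times> coords n"
proof -
  have "int n - 1 \<in> coords n"
    unfolding coords_def using assms by (intro image_eqI[where x = "n - 1"]) (auto simp: of_nat_diff)
  moreover from coords_uminus[OF this] have "1 - int n \<in> coords n"
    by simp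
  ultimately show ?thesis
    by (auto simp: corners_def)
qed

lemma turn_corners:
  assumes "p \<in> corners n"
  shows "turn f p \<in> corners n"
proof -
  define S where "S = {int n - 1, 1 - int n}"
  have "- u \<in> S" if "u \<in> S" for u
    using that by (auto simp: S_def)
  then show ?thesis
    using assms unfolding corners_def S_def[symmetric] by (cases f; cases p) auto
qed

lemma corners_sgn:
  assumes "n \<ge> 2" "(x, y, z) \<in> corners n"
  shows "sgn x = 1 \<or> sgn x = -1" "sgn y = 1 \<or> sgn y = -1" "sgn z = 1 \<or> sgn z = -1"
proof -
  have "x \<noteq> 0" "y \<noteq> 0" "z \<noteq> 0"
    using assms by (auto simp: corners_def)
  then show "sgn x = 1 \<or> sgn x = -1" "sgn y = 1 \<or> sgn y = -1" "sgn z = 1 \<or> sgn z = -1"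
    by (simp_all add: sgn_if)
qed

lemma corner_facelet_iff:
  assumes "n \<ge> 2" and "(x, y, z) \<in> corners n"
  shows "((x, y, z), d) \<in> facelets n \<longleftrightarrow> d \<in> {(sgn x, 0, 0), (0, sgn y, 0), (0, 0, sgn z)}"
proof -
  have "(x, y, z) \<in> coords n \<times> coords n \<times> coords n"
    using assms corners_subset_coords by blast
  then have "((x, y, z), d) \<in> facelets n \<longleftrightarrow> d \<in> range outward \<and> dot (x, y, z) d = int n - 1"
    by (simp add: facelets_def)
  also have "\<dots> \<longleftrightarrow>
      d = (1, 0, 0) \<and> x = int n - 1 \<or> d = (-1, 0, 0) \<and> - x = int n - 1 \<or>
      d = (0, 1, 0) \<and> y = int n - 1 \<or> d = (0, -1, 0) \<and> - y = int n - 1 \<or>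
      d = (0, 0, 1) \<and> z = int n - 1 \<or> d = (0, 0, -1) \<and> - z = int n - 1"
    unfolding range_outward insert_iff empty_iff
    by (intro iffI; elim conjE disjE) simp_all
  also have "\<dots> \<longleftrightarrow>
      d = (1, 0, 0) \<and> sgn x = 1 \<or> d = (-1, 0, 0) \<and> sgn x = -1 \<or>
      d = (0, 1, 0) \<and> sgn y = 1 \<or> d = (0, -1, 0) \<and> sgn y = -1 \<or>
      d = (0, 0, 1) \<and> sgn z = 1 \<or> d = (0, 0, -1) \<and> sgn z = -1"
  proof -
    have sgn: "(u = int n - 1 \<longleftrightarrow> sgn u = 1) \<and> (- u = int n - 1 \<longleftrightarrow> sgn u = -1)"
      if "u \<in> {int n - 1, 1 - int n}" for u
      using that assms(1) by (auto simp: sgn_if)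
    have "x \<in> {int n - 1, 1 - int n}" "y \<in> {int n - 1, 1 - int n}" "z \<in> {int n - 1, 1 - int n}"
      using assms(2) unfolding corners_def by blast+
    then show ?thesis
      by (simp only: sgn)
  qed
  also have "\<dots> \<longleftrightarrow> d \<in> {(sgn x, 0, 0), (0, sgn y, 0), (0, 0, sgn z)}"
    using corners_sgn[OF assms] by (elim disjE) simp_all
  finally show ?thesis .
qed

text \<open>A cubie has one sticker for each extremal coordinate; \<open>n \<ge> 2\<close> keeps the
  two extreme values distinct, so that no coordinate counts twice.\<close>

lemma corner_iff_corners:
  assumes "n \<ge> 2"
  shows "corner n p \<longleftrightarrow> p \<in> corners n"
proof -
  define D where "D = {d \<in> range outward. dot p d = int n - 1}"
  have "{x \<in> facelets n. fst x = p} =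
      (if p \<in> coords n \<times> coords n \<times> coords n then Pair p ` D else {})"
    by (auto simp: facelets_def D_def)
  then have "corner n p \<longleftrightarrow> p \<in> coords n \<times> coords n \<times> coords n \<and> card D = 3"
    by (simp add: corner_def card_image inj_on_def)
  also have "card D = 3 \<longleftrightarrow> p \<in> corners n"
  proof -
    obtain x y z where p: "p = (x, y, z)"
      by (cases p)
    have "card D = (\<Sum>d \<in> range outward. if dot p d = int n - 1 then 1 else 0)"
      unfolding D_def by (simp add: range_outward flip: sum.inter_filter)
    also have "\<dots> =
        ((if x = int n - 1 then 1 else 0) + (if x = 1 - int n then 1 else 0)) +
        ((if y = int n - 1 then 1 else 0) + (if y = 1 - int n then 1 else 0)) +
        ((if z = int n - 1 then 1 else 0) + (if z = 1 - int n then 1 else 0))"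
    proof -
      have "- u = int n - 1 \<longleftrightarrow> u = 1 - int n" for u
        by linarith
      then show ?thesis
        by (simp add: range_outward p)
    qed
    also have "\<dots> = (if x \<in> {int n - 1, 1 - int n} then 1 else 0) +
        (if y \<in> {int n - 1, 1 - int n} then 1 else 0) +
        (if z \<in> {int n - 1, 1 - int n} then 1 else 0)"
      using assms by simp
    finally show ?thesis
      by (simp add: p corners_def)
  qed
  finally show ?thesis
    using corners_subset_coords[OF assms] by blast
qed

text \<open>The \<open>axis\<close> numbers at a corner are 0, 1 and -1; multiplying them by
  \<open>chirality\<close>, which is 1 or -1 there, keeps them distinct modulo 3.\<close>

lemma orient_inj:
  assumes "n \<ge> 2" and "p \<in> corners n" and "(p, d) \<in> facelets n" and "(p, e) \<in> facelets n"
    and "orient (p, d) mod 3 = orient (p, e) mod 3"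
  shows "d = e"
proof -
  obtain x y z where p: "p = (x, y, z)"
    by (cases p)
  have sgns: "sgn x = 1 \<or> sgn x = -1" "sgn y = 1 \<or> sgn y = -1" "sgn z = 1 \<or> sgn z = -1"
    using corners_sgn assms(1,2) p by blast+
  then have sq: "(sgn y)\<^sup>2 = 1" "(sgn z)\<^sup>2 = 1"
    by auto
  have "chirality p = 1 \<or> chirality p = -1"
    using sgns by (auto simp: p)
  moreover have "d \<in> {(sgn x, 0, 0), (0, sgn y, 0), (0, 0, sgn z)}"
      "e \<in> {(sgn x, 0, 0), (0, sgn y, 0), (0, 0, sgn z)}"
    using assms corner_facelet_iff p by blast+
  ultimately show ?thesis
    using assms(5) unfolding insert_iff empty_iff
    by (elim disjE) (simp_all add: orient_def sq)
qed

section \<open>Corner permutations with twists under the group operations\<close>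

text \<open>\<open>t\<close> is indexed by positions before \<open>g\<close> acts, and its integer
  values matter only modulo 3. Divisibility of the sum is built in so that it is carried through
  products and inverses.\<close>

definition twisted :: "nat \<Rightarrow> (facelet \<Rightarrow> facelet) \<Rightarrow> (vec \<Rightarrow> vec) \<Rightarrow> (vec \<Rightarrow> int) \<Rightarrow> bool" where
  "twisted n g \<sigma> t \<longleftrightarrow>
     bij_betw \<sigma> (corners n) (corners n) \<and> 3 dvd (\<Sum>p \<in> corners n. t p) \<and>
     (\<forall>x \<in> facelets n. fst x \<in> corners n \<longrightarrow>
        fst (g x) = \<sigma> (fst x) \<and> orient (g x) mod 3 = (orient x + t (fst x)) mod 3)"

lemma BijGroup_mult_apply:
  assumes "g \<in> carrier (BijGroup S)" "h \<in> carrier (BijGroup S)" "x \<in> S"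
  shows "(g \<otimes>\<^bsub>BijGroup S\<^esub> h) x = g (h x)"
  using assms by (simp add: BijGroup_def compose_eq)

lemma BijGroup_apply_closed:
  assumes "g \<in> carrier (BijGroup S)" "x \<in> S"
  shows "g x \<in> S"
  using assms Bij_imp_funcset by (fastforce simp: BijGroup_def)

lemma twisted_one: "twisted n \<one>\<^bsub>BijGroup (facelets n)\<^esub> (\<lambda>p. p) (\<lambda>_. 0)"
  by (simp add: twisted_def BijGroup_def bij_betw_def)

text \<open>The twist due to \<open>g\<close> is read at the place to which \<open>h\<close> has
  carried the corner; reindexing along the bijection \<tau> leaves the sum of \<open>s\<close>
  unchanged.\<close>

lemma twisted_mult:
  assumes g: "g \<in> carrier (BijGroup (facelets n))" "twisted n g \<sigma> s"
    and h: "h \<in> carrier (BijGroup (facelets n))" "twisted n h \<tau> t"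
  shows "twisted n (g \<otimes>\<^bsub>BijGroup (facelets n)\<^esub> h) (\<sigma> \<circ> \<tau>) (\<lambda>p. t p + s (\<tau> p))"
proof -
  have \<tau>: "bij_betw \<tau> (corners n) (corners n)"
    using h by (simp add: twisted_def)
  have "(\<Sum>p \<in> corners n. s (\<tau> p)) = (\<Sum>p \<in> corners n. s p)"
    by (rule sum.reindex_bij_betw[OF \<tau>])
  then have "3 dvd (\<Sum>p \<in> corners n. t p + s (\<tau> p))"
    using g h by (simp add: twisted_def sum.distrib)
  moreover have "orient (g (h x)) mod 3 = (orient x + (t (fst x) + s (\<tau> (fst x)))) mod 3
      \<and> fst (g (h x)) = \<sigma> (\<tau> (fst x))"
    if x: "x \<in> facelets n" "fst x \<in> corners n" for x
  proof -
    have "fst (h x) = \<tau> (fst x)" "orient (h x) mod 3 = (orient x + t (fst x)) mod 3"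
      using h x by (auto simp: twisted_def)
    moreover have "h x \<in> facelets n"
      using h x by (simp add: BijGroup_apply_closed)
    moreover have "\<tau> (fst x) \<in> corners n"
      using \<tau> x by (auto simp: bij_betw_def)
    ultimately have "orient (g (h x)) mod 3 = (orient (h x) + s (\<tau> (fst x))) mod 3"
        and "fst (g (h x)) = \<sigma> (\<tau> (fst x))"
      using g by (simp_all add: twisted_def)
    with \<open>orient (h x) mod 3 = _\<close> show ?thesis
      by (metis mod_add_left_eq add.assoc)
  qed
  ultimately show ?thesis
    using g h by (auto simp: twisted_def BijGroup_mult_apply intro: bij_betw_trans)
qed

lemma twisted_inv:
  assumes g: "g \<in> carrier (BijGroup (facelets n))" "twisted n g \<sigma> t"
  defines "\<tau> \<equiv> inv_into (corners n) \<sigma>"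
  shows "twisted n (inv\<^bsub>BijGroup (facelets n)\<^esub> g) \<tau> (\<lambda>p. - t (\<tau> p))"
proof -
  interpret B: group "BijGroup (facelets n)"
    by (rule group_BijGroup)
  let ?CF = "{x \<in> facelets n. fst x \<in> corners n}"
  have \<sigma>: "bij_betw \<sigma> (corners n) (corners n)"
    using g by (simp add: twisted_def)
  have \<tau>: "bij_betw \<tau> (corners n) (corners n)"
    unfolding \<tau>_def by (rule bij_betw_inv_into[OF \<sigma>])
  \<comment> \<open>\<open>g\<close> maps the finite set of corner stickers injectively into itself,
    hence onto, so every corner sticker has a preimage among the corner stickers.\<close>
  have "g ` ?CF \<subseteq> ?CF"
    using g \<sigma> by (auto simp: twisted_def BijGroup_apply_closed bij_betw_def)
  moreover have "inj_on g ?CF"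
    using g by (auto simp: BijGroup_def Bij_def bij_betw_def intro: inj_on_subset)
  ultimately have onto: "g ` ?CF = ?CF"
    by (intro endo_inj_surj) (simp_all add: finite_facelets)
  have "fst ((inv\<^bsub>BijGroup (facelets n)\<^esub> g) x) = \<tau> (fst x) \<and>
      orient ((inv\<^bsub>BijGroup (facelets n)\<^esub> g) x) mod 3 = (orient x + - t (\<tau> (fst x))) mod 3"
    if x: "x \<in> facelets n" "fst x \<in> corners n" for x
  proof -
    obtain y where y: "y \<in> facelets n" "fst y \<in> corners n" "x = g y"
      using onto x by blast
    have "(inv\<^bsub>BijGroup (facelets n)\<^esub> g) x =
        (inv\<^bsub>BijGroup (facelets n)\<^esub> g \<otimes>\<^bsub>BijGroup (facelets n)\<^esub> g) y"
      using BijGroup_mult_apply[OF B.inv_closed[OF g(1)] g(1) y(1)] y(3) by simp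
    also have "\<dots> = y"
      unfolding B.l_inv[OF g(1)] using y by (simp add: BijGroup_def)
    finally have inv: "(inv\<^bsub>BijGroup (facelets n)\<^esub> g) x = y" .
    have *: "fst x = \<sigma> (fst y)" "orient x mod 3 = (orient y + t (fst y)) mod 3"
      using g y by (auto simp: twisted_def)
    then have **: "\<tau> (fst x) = fst y"
      using \<sigma> y by (simp add: \<tau>_def bij_betw_inv_into_left)
    have "(orient x - t (fst y)) mod 3 = (orient y + t (fst y) - t (fst y)) mod 3"
      using *(2) by (metis mod_diff_left_eq)
    with ** inv show ?thesis
      by simp
  qed
  moreover have "(\<Sum>p \<in> corners n. t (\<tau> p)) = (\<Sum>p \<in> corners n. t p)"
    by (rule sum.reindex_bij_betw[OF \<tau>])
  ultimately show ?thesis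
    using \<tau> g by (simp add: twisted_def sum_negf)
qed

section \<open>Twists caused by the moves\<close>

text \<open>The value is the number a of the axis of rotation. A quarter turn keeps this axis and
  swaps the other two, which on residues modulo 3 is the reflection i \<mapsto> -a - i.\<close>

fun turn_twist :: "face \<Rightarrow> int" where
  "turn_twist Right = 0"
| "turn_twist Left = 0"
| "turn_twist Up = 1"
| "turn_twist Down = 1"
| "turn_twist Front = -1"
| "turn_twist Back = -1"

lemma chirality_turn: "chirality (turn f p) = - chirality p"
  by (cases f; cases p) simp_all

lemma axis_turn:
  assumes "d \<in> range outward"
  shows "3 dvd axis (turn f d) + axis d + turn_twist f"
proof -
  obtain a b c where d: "d = (a, b, c)"
    by (cases d)
  then have *: "a\<^sup>2 + b\<^sup>2 + c\<^sup>2 = 1"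
    using assms by (auto simp: range_outward)
  have "axis (turn f d) + axis d + turn_twist f \<in> {0, 3 * b\<^sup>2, - 3 * c\<^sup>2}"
    using * by (cases f) (simp_all add: d)
  then show ?thesis
    by auto
qed

text \<open>The reflection of the axis numbers and the sign change of \<open>chirality\<close>
  cancel, so all stickers of a corner are shifted by the same amount.\<close>

lemma orient_turn:
  assumes "d \<in> range outward"
  shows "orient (turn f p, turn f d) mod 3 = (orient (p, d) + chirality p * turn_twist f) mod 3"
proof -
  obtain k where "axis (turn f d) + axis d + turn_twist f = 3 * k"
    using axis_turn[OF assms] by blast
  then have eq: "axis (turn f d) = 3 * k - axis d - turn_twist f"
    by simp
  have "orient (turn f p, turn f d) =
      orient (p, d) + chirality p * turn_twist f + 3 * (- k * chirality p)"
    unfolding orient_def fst_conv snd_conv chirality_turn eq by (simp add: algebra_simps)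
  then show ?thesis
    by (metis mod_mult_self2)
qed

lemma corner_in_slice_iff:
  assumes "n \<ge> 2" "1 \<le> k" "k \<le> n div 2" "p \<in> corners n"
  shows "p \<in> slice n f k \<longleftrightarrow> k = 1 \<and> dot p (outward f) = int n - 1"
proof -
  have "dot p (outward f) = int n - 1 \<or> dot p (outward f) = 1 - int n"
    using assms(4) by (cases f) (auto simp: corners_def)
  \<comment> \<open>This excludes \<open>k = n\<close>, the depth at which the slice would be the
    opposite face.\<close>
  moreover have "2 * int k \<le> int n"
    using assms(3) by linarith
  ultimately show ?thesis
    using assms by (auto simp: slice_def)
qed

lemma sum_corners:
  "(\<Sum>p \<in> corners n. h p) = (\<Sum>x \<in> {int n - 1, 1 - int n}.
    \<Sum>y \<in> {int n - 1, 1 - int n}. \<Sum>z \<in> {int n - 1, 1 - int n}. h (x, y, z))"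
  by (simp only: corners_def sum.cartesian_product')

lemma twisted_move:
  assumes "n \<ge> 2" "1 \<le> k" "k \<le> n div 2"
  shows "\<exists>\<sigma> t. twisted n (move n f k) \<sigma> t"
proof (intro exI)
  define \<sigma> where "\<sigma> p = (if p \<in> slice n f k then turn f p else p)" for p
  define t where "t p = (if p \<in> slice n f k then chirality p * turn_twist f else 0)" for p
  have slice: "turn f p \<in> slice n f k \<longleftrightarrow> p \<in> slice n f k" for p
    using dot_turn[of f p "outward f"] by (simp add: turn_outward slice_def)
  have "\<sigma> ` corners n \<subseteq> corners n"
    using turn_corners by (auto simp: \<sigma>_def)
  moreover have "inj_on \<sigma> (corners n)"
    using slice by (auto simp: inj_on_def \<sigma>_def turn_inj split: if_splits)
  ultimately have "bij_betw \<sigma> (corners n) (corners n)"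
    by (simp add: bij_betw_def endo_inj_surj finite_corners)
  moreover have "(\<Sum>p \<in> corners n. t p) = 0"
  proof -
    have "(\<Sum>p \<in> corners n. t p) =
      (\<Sum>p \<in> corners n. if k = 1 \<and> dot p (outward f) = int n - 1
         then chirality p * turn_twist f else 0)"
      by (rule sum.cong) (simp_all add: t_def corner_in_slice_iff[OF assms])
    \<comment> \<open>Chirality alternates around the four corners of a face, so their shifts
      cancel; inner slices contain no corners at all.\<close>
    also have "\<dots> = 0"
      unfolding sum_corners using assms(1) by (cases f; cases "k = 1") (simp_all add: sgn_if)
    finally show ?thesis .
  qed
  moreover have "fst (move n f k (p, d)) = \<sigma> p \<and>
      orient (move n f k (p, d)) mod 3 = (orient (p, d) + t p) mod 3"
    if pd: "(p, d) \<in> facelets n" "p \<in> corners n" for p d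
  proof -
    have "d \<in> range outward"
      using pd by (simp add: facelets_def)
    then have "orient (turn f p, turn f d) mod 3 = (orient (p, d) + chirality p * turn_twist f) mod 3"
      by (rule orient_turn)
    then show ?thesis
      using pd by (simp add: move_def \<sigma>_def t_def)
  qed
  ultimately show "twisted n (move n f k) \<sigma> t"
    by (auto simp: twisted_def)
qed

section \<open>The twist invariant on the whole cube group\<close>

lemma rubik_group_carrier_subset: "carrier (rubik_group n) \<subseteq> carrier (BijGroup (facelets n))"
  unfolding rubik_group_def by (rule group.carrier_subgroup_generated_subset[OF group_BijGroup])

lemma rubik_group_mult_apply:
  assumes "g \<in> carrier (rubik_group n)" "h \<in> carrier (rubik_group n)" "x \<in> facelets n"
  shows "(g \<otimes>\<^bsub>rubik_group n\<^esub> h) x = g (h x)"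
proof -
  have "g \<in> carrier (BijGroup (facelets n))" "h \<in> carrier (BijGroup (facelets n))"
    using assms rubik_group_carrier_subset by blast+
  then show ?thesis
    using assms(3) by (simp add: rubik_group_def BijGroup_mult_apply)
qed

text \<open>Elements with a twist description form a subgroup of the permutations that contains
  every move, hence the group generated by the moves.\<close>

lemma rubik_group_twisted:
  assumes "n \<ge> 2" "g \<in> carrier (rubik_group n)"
  obtains \<sigma> t where "twisted n g \<sigma> t"
proof -
  interpret B: group "BijGroup (facelets n)"
    by (rule group_BijGroup)
  define H where "H = {g \<in> carrier (BijGroup (facelets n)). \<exists>\<sigma> t. twisted n g \<sigma> t}"
  have "subgroup H (BijGroup (facelets n))"
  proof (rule B.subgroupI)
    show "H \<subseteq> carrier (BijGroup (facelets n))"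
      by (auto simp: H_def)
    show "H \<noteq> {}"
      using twisted_one B.one_closed by (auto simp: H_def)
  next
    fix g assume "g \<in> H"
    then show "inv\<^bsub>BijGroup (facelets n)\<^esub> g \<in> H"
      using twisted_inv B.inv_closed by (fastforce simp: H_def)
  next
    fix g h assume "g \<in> H" "h \<in> H"
    then show "g \<otimes>\<^bsub>BijGroup (facelets n)\<^esub> h \<in> H"
      using twisted_mult B.m_closed by (fastforce simp: H_def)
  qed
  moreover have "{move n f k | f k. 1 \<le> k \<and> k \<le> n div 2} \<subseteq> H"
    using twisted_move[OF assms(1)] move_in_carrier by (auto simp: H_def)
  ultimately have "carrier (rubik_group n) \<subseteq> H"
    unfolding rubik_group_def by (rule B.subgroup_generated_minimal)
  with assms(2) that show thesis
    by (auto simp: H_def)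
qed

section \<open>Twists of pure corner reorientations\<close>

text \<open>The reference sticker lies on the x axis and has number 0, so the number of its image is
  the twist itself.\<close>

definition twist :: "(facelet \<Rightarrow> facelet) \<Rightarrow> vec \<Rightarrow> int" where
  "twist g p = orient (g (p, (sgn (fst p), 0, 0))) mod 3"

lemma reference_facelet:
  assumes "n \<ge> 2" "p \<in> corners n"
  shows "(p, (sgn (fst p), 0, 0)) \<in> facelets n"
  using assms corner_facelet_iff by (cases p) auto

text \<open>Evaluation at the reference stickers determines any twist function modulo 3, so
  \<open>twist g\<close> can replace it without affecting divisibility of the sum.\<close>

lemma corner_orientations_twisted:
  assumes "n \<ge> 2" "g \<in> corner_orientations n"
  obtains \<sigma> where "twisted n g \<sigma> (twist g)"
proof -
  obtain \<sigma> t where t: "twisted n g \<sigma> t"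
    using assms by (auto simp: corner_orientations_def elim: rubik_group_twisted)
  have tw: "twist g p = t p mod 3" if "p \<in> corners n" for p
    using t that reference_facelet[OF assms(1) that] by (auto simp: twist_def twisted_def orient_def)
  have "(\<Sum>p \<in> corners n. twist g p) mod 3 = (\<Sum>p \<in> corners n. t p mod 3) mod 3"
    using tw by (simp cong: sum.cong)
  also have "\<dots> = 0"
    using t by (simp add: mod_sum_eq twisted_def)
  finally have "3 dvd (\<Sum>p \<in> corners n. twist g p)"
    by presburger
  then have "twisted n g \<sigma> (twist g)"
    using t by (auto simp: twisted_def tw mod_add_right_eq)
  then show thesis
    by (rule that)
qed

lemma corner_orientations_apply:
  assumes "n \<ge> 2" "g \<in> corner_orientations n" "x \<in> facelets n"
  shows "g x \<in> facelets n" "fst (g x) = fst x"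
    and "fst x \<in> corners n \<Longrightarrow> orient (g x) mod 3 = (orient x + twist g (fst x)) mod 3"
    and "fst x \<notin> corners n \<Longrightarrow> g x = x"
proof -
  have "g \<in> carrier (BijGroup (facelets n))"
    using assms(2) rubik_group_carrier_subset by (auto simp: corner_orientations_def)
  then show "g x \<in> facelets n"
    using assms(3) by (rule BijGroup_apply_closed)
  show "fst (g x) = fst x" "fst x \<notin> corners n \<Longrightarrow> g x = x"
    using assms by (auto simp: corner_orientations_def corner_iff_corners)
  obtain \<sigma> where "twisted n g \<sigma> (twist g)"
    using assms(1,2) by (rule corner_orientations_twisted)
  then show "fst x \<in> corners n \<Longrightarrow> orient (g x) mod 3 = (orient x + twist g (fst x)) mod 3"
    using assms by (simp add: twisted_def)
qed

text \<open>Since corners stay in place, both twists are read at the same position and simply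
  add.\<close>

lemma twist_mult:
  assumes "n \<ge> 2" "g \<in> corner_orientations n" "h \<in> corner_orientations n" "p \<in> corners n"
  shows "twist (g \<otimes>\<^bsub>rubik_group n\<^esub> h) p = (twist g p + twist h p) mod 3"
proof -
  let ?r = "(p, (sgn (fst p), 0, 0))"
  have r: "?r \<in> facelets n"
    using assms(1,4) by (rule reference_facelet)
  note h = corner_orientations_apply[OF assms(1,3) r]
  have "(g \<otimes>\<^bsub>rubik_group n\<^esub> h) ?r = g (h ?r)"
    using assms r by (intro rubik_group_mult_apply) (auto simp: corner_orientations_def)
  then have "twist (g \<otimes>\<^bsub>rubik_group n\<^esub> h) p = orient (g (h ?r)) mod 3"
    by (simp add: twist_def)
  also have "\<dots> = (orient (h ?r) + twist g p) mod 3"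
    using corner_orientations_apply(3)[OF assms(1,2) h(1)] h(2) assms(4) by simp
  also have "\<dots> = (twist h p + twist g p) mod 3"
    by (simp add: twist_def mod_add_left_eq)
  finally show ?thesis
    by (simp add: add.commute)
qed

text \<open>A corner sticker is determined by its position and its number modulo 3, and all other
  stickers are fixed by both elements.\<close>

lemma corner_orientations_eqI:
  assumes "n \<ge> 2" "g \<in> corner_orientations n" "h \<in> corner_orientations n"
    and "\<And>p. p \<in> corners n \<Longrightarrow> twist g p = twist h p"
  shows "g = h"
proof -
  have ext: "g \<in> extensional (facelets n)" "h \<in> extensional (facelets n)"
    using assms(2,3) rubik_group_carrier_subset
    by (auto simp: corner_orientations_def BijGroup_def Bij_def)
  show ?thesis
  proof (rule extensionalityI[OF ext])
    fix x assume x: "x \<in> facelets n"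
    note g = corner_orientations_apply[OF assms(1,2) x]
    note h = corner_orientations_apply[OF assms(1,3) x]
    show "g x = h x"
    proof (cases "fst x \<in> corners n")
      case True
      then have "orient (g x) mod 3 = orient (h x) mod 3"
        using g(3) h(3) assms(4) by simp
      then have "snd (g x) = snd (h x)"
        using orient_inj[OF assms(1) True, of "snd (g x)" "snd (h x)"] g(1,2) h(1,2)
        by (metis prod.collapse)
      then show ?thesis
        using g(2) h(2) by (simp add: prod_eq_iff)
    next
      case False
      then show ?thesis
        using g(4) h(4) by simp
    qed
  qed
qed

section \<open>A path through the corners and the action of outermost turns\<close>

fun scale :: "int \<Rightarrow> vec \<Rightarrow> vec" where
  "scale N (a, b, c) = (N * a, N * b, N * c)"

text \<open>Consecutive entries differ in exactly one sign, so they are joined by an edge of the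
  cube.\<close>

definition corner_path :: "vec list" where
  "corner_path = [(1, 1, 1), (1, 1, -1), (1, -1, -1), (1, -1, 1),
     (-1, -1, 1), (-1, -1, -1), (-1, 1, -1), (-1, 1, 1)]"

definition corner_at :: "nat \<Rightarrow> nat \<Rightarrow> vec" where
  "corner_at n i = scale (int n - 1) (corner_path ! i)"

lemma lessThan_8: "{..<8} = {0, 1, 2, 3, 4, 5, 6, 7 :: nat}"
  by auto

lemma corner_at_bij:
  assumes "n \<ge> 2"
  shows "bij_betw (corner_at n) {..<8} (corners n)"
proof -
  have "corner_at n ` {..<8} = corners n"
    unfolding lessThan_8 by (simp add: corner_at_def corner_path_def corners_def numeral_eq_Suc) blast
  moreover have "inj_on (corner_at n) {..<8}"
    unfolding lessThan_8 using assms by (simp add: corner_at_def corner_path_def numeral_eq_Suc)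
  ultimately show ?thesis
    by (simp add: bij_betw_def)
qed

lemma corner_at_in_corners:
  assumes "n \<ge> 2" "i < 8"
  shows "corner_at n i \<in> corners n"
  using corner_at_bij[OF assms(1)] assms(2) by (auto simp: bij_betw_def)

text \<open>
  Whether an outermost slice contains a cubie depends only on which of its coordinates are
  extremal. The vector \<open>s\<close> records these as \<open>1\<close> or \<open>-1\<close>, all others as \<open>0\<close>; the
  effect of a sequence of outermost turns on \<open>v\<close> is then a computation independent of \<open>n\<close>.
\<close>

fun drag :: "face list \<Rightarrow> vec \<Rightarrow> vec \<Rightarrow> vec" where
  "drag [] s v = v"
| "drag (f # fs) s v =
     (if dot s (outward f) = 1 then drag fs (turn f s) (turn f v) else drag fs s v)"

text \<open>The list is read from left to right: its head acts first and is therefore the rightmost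
  factor.\<close>

fun word :: "nat \<Rightarrow> face list \<Rightarrow> facelet \<Rightarrow> facelet" where
  "word n [] = \<one>\<^bsub>rubik_group n\<^esub>"
| "word n (f # fs) = word n fs \<otimes>\<^bsub>rubik_group n\<^esub> move n f 1"

definition side :: "nat \<Rightarrow> int \<Rightarrow> int" where
  "side n u = (if u = int n - 1 then 1 else if u = 1 - int n then -1 else 0)"

fun sides :: "nat \<Rightarrow> vec \<Rightarrow> vec" where
  "sides n (x, y, z) = (side n x, side n y, side n z)"

lemma side_uminus: "n \<ge> 2 \<Longrightarrow> side n (- u) = - side n u"
  by (auto simp: side_def)

lemma sides_turn: "n \<ge> 2 \<Longrightarrow> sides n (turn f p) = turn f (sides n p)"
  by (cases f; cases p) (simp_all add: side_uminus)

lemma slice_iff_sides: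
  assumes "n \<ge> 2"
  shows "p \<in> slice n f 1 \<longleftrightarrow> dot (sides n p) (outward f) = 1"
proof -
  have "side n u = 1 \<longleftrightarrow> u = int n - 1" "side n u = -1 \<longleftrightarrow> - u = int n - 1" for u
    using assms by (auto simp: side_def)
  then show ?thesis
    by (cases f; cases p) (simp_all add: slice_def minus_equation_iff[of _ 1] eq_commute[of "-1"])
qed

lemma move_in_rubik_group:
  assumes "n \<ge> 2"
  shows "move n f 1 \<in> carrier (rubik_group n)"
proof -
  have "1 \<le> n div 2"
    using assms by linarith
  then show ?thesis
    unfolding rubik_group_def carrier_subgroup_generated
    using move_in_carrier by (intro generate.incl) blast
qed

lemma word_in_rubik_group:
  assumes "n \<ge> 2"
  shows "word n w \<in> carrier (rubik_group n)"
proof -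
  interpret group "rubik_group n"
    by (rule group_rubik_group)
  show ?thesis
    by (induction w) (use move_in_rubik_group[OF assms] in auto)
qed

text \<open>\<open>sides\<close> commutes with turns, so the record of extremal coordinates follows
  the cubie and selects the same rotations for its position and its normal.\<close>

lemma word_apply:
  assumes "n \<ge> 2" "(p, d) \<in> facelets n"
  shows "word n w (p, d) = (drag w (sides n p) p, drag w (sides n p) d)"
  using assms(2)
proof (induction w arbitrary: p d)
  case Nil
  then show ?case
    by (simp add: rubik_group_def BijGroup_def)
next
  case (Cons f w)
  have "move n f 1 (p, d) \<in> facelets n"
    using BijGroup_apply_closed[OF move_in_carrier] Cons.prems by blast
  moreover have "word n (f # w) (p, d) = word n w (move n f 1 (p, d))"
    using rubik_group_mult_apply[OF word_in_rubik_group move_in_rubik_group] assms(1) Cons.prems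
    by simp
  moreover have "move n f 1 (p, d) =
      (if dot (sides n p) (outward f) = 1 then (turn f p, turn f d) else (p, d))"
    using Cons.prems slice_iff_sides[OF assms(1)] by (simp add: move_def)
  ultimately show ?case
    using Cons.IH by (simp add: sides_turn[OF assms(1)] split: if_splits)
qed

text \<open>
  With \<open>r\<close>, \<open>u\<close>, \<open>d\<close> standing for R, U, D, this is \<open>(R' D' R D)\<^sup>2 U (D' R' D R)\<^sup>2 U'\<close>,
  read from left to right and with inverse turns written as three turns.
\<close>

definition twister :: "face \<Rightarrow> face \<Rightarrow> face \<Rightarrow> face list" where
  "twister r u d =
     [r, r, r, d, d, d, r, d] @ [r, r, r, d, d, d, r, d] @ [u] @
     [d, d, d, r, r, r, d, r] @ [d, d, d, r, r, r, d, r] @ [u, u, u]"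

text \<open>The \<open>k\<close>-th entry only twists the \<open>k\<close>-th corner of the path and its successor.\<close>

definition twisters :: "face list list" where
  "twisters =
     [twister Right Up Down, twister Right Back Front, twister Right Down Up,
      twister Front Down Up, twister Left Down Up, twister Left Back Front,
      twister Left Up Down]"

section \<open>Evaluation of the twisters\<close>

lemma drag_dot: "dot (drag w s u) (drag w s v) = dot u v"
  by (induction w arbitrary: s u v) (simp_all add: dot_turn)

text \<open>Transfers computations on vectors with entries 1 and -1 to the corners of a cube of any
  size.\<close>

lemma drag_scale: "drag w s (scale N v) = scale N (drag w s v)"
proof (induction w arbitrary: s v)
  case (Cons f w)
  have "turn f (scale N v) = scale N (turn f v)"
    by (cases f; cases v) simp_all
  then show ?case
    by (simp add: Cons.IH)
qed simp

text \<open>Only finitely many records contain a zero, and for each of them a rotation is determined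
  by the three basis vectors, so evaluation settles all \<open>n\<close> at once.\<close>

lemma drag_twisters_noncorner:
  assumes "w \<in> set twisters" "a \<in> {-1, 0, 1}" "b \<in> {-1, 0, 1}" "c \<in> {-1, 0, 1}"
    and "a = 0 \<or> b = 0 \<or> c = 0"
  shows "drag w (a, b, c) v = v"
proof -
  have "\<forall>w \<in> set twisters. \<forall>a \<in> set [-1, 0, 1]. \<forall>b \<in> set [-1, 0, 1]. \<forall>c \<in> set [-1, 0, 1].
      a = 0 \<or> b = 0 \<or> c = 0 \<longrightarrow>
      (\<forall>e \<in> set [(1, 0, 0), (0, 1, 0), (0, 0, 1)]. drag w (a, b, c) e = e)"
    by code_simp
  then have e: "drag w (a, b, c) e = e" if "e \<in> {(1, 0, 0), (0, 1, 0), (0, 0, 1)}" for e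
    using assms that unfolding list.set by blast
  \<comment> \<open>\<open>drag\<close> preserves the dot product and fixes \<open>e\<close>, so
    \<open>v\<close> and its image have the same coordinates.\<close>
  have "dot (drag w (a, b, c) v) e = dot v e" if "e \<in> {(1, 0, 0), (0, 1, 0), (0, 0, 1)}" for e
    using drag_dot[of w "(a, b, c)" v e] unfolding e[OF that] .
  from this[of "(1, 0, 0)"] this[of "(0, 1, 0)"] this[of "(0, 0, 1)"] show ?thesis
    by (cases v; cases "drag w (a, b, c) v") simp
qed

lemma drag_twisters_corner:
  assumes "w \<in> set twisters" "i < 8"
  shows "drag w (corner_path ! i) (corner_path ! i) = corner_path ! i"
proof -
  have "\<forall>w \<in> set twisters. \<forall>s \<in> set corner_path. drag w s s = s"
    by code_simp
  moreover have "corner_path ! i \<in> set corner_path"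
    using assms(2) by (intro nth_mem) (simp add: corner_path_def)
  ultimately show ?thesis
    using assms(1) by blast
qed

text \<open>The twist matrix is triangular with unit diagonal, which allows twists to be prescribed
  one corner at a time along the path.\<close>

lemma drag_twisters_orient:
  assumes "j \<le> k" "k < 7"
  shows "chirality (corner_path ! j) *
      axis (drag (twisters ! k) (corner_path ! j) (fst (corner_path ! j), 0, 0)) mod 3 =
    (if j = k then 1 else 0)"
proof -
  have "\<forall>k \<in> set [0..<7]. \<forall>j \<in> set [0..<Suc k]. chirality (corner_path ! j) *
      axis (drag (twisters ! k) (corner_path ! j) (fst (corner_path ! j), 0, 0)) mod 3 =
    (if j = k then 1 else 0)"
    by code_simp
  with assms show ?thesis
    by simp
qed

lemma less_8_cases:
  assumes "i < (8 :: nat)"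
  obtains "i = 0" | "i = 1" | "i = 2" | "i = 3" | "i = 4" | "i = 5" | "i = 6" | "i = 7"
  using assms by linarith

lemma corner_at_signs:
  assumes "n \<ge> 2" "i < 8"
  shows "sides n (corner_at n i) = corner_path ! i"
    and "chirality (corner_at n i) = chirality (corner_path ! i)"
    and "sgn (fst (corner_at n i)) = fst (corner_path ! i)"
proof -
  have "sides n (corner_at n i) = corner_path ! i \<and>
      chirality (corner_at n i) = chirality (corner_path ! i) \<and>
      sgn (fst (corner_at n i)) = fst (corner_path ! i)"
    using assms(2,1) by (elim less_8_cases; simp add: corner_at_def corner_path_def side_def)
  then show "sides n (corner_at n i) = corner_path ! i"
      "chirality (corner_at n i) = chirality (corner_path ! i)"
      "sgn (fst (corner_at n i)) = fst (corner_path ! i)"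
    by blast+
qed

lemma twister_in_corner_orientations:
  assumes "n \<ge> 2" "w \<in> set twisters"
  shows "word n w \<in> corner_orientations n"
proof -
  have "fst (word n w (p, d)) = p \<and> (p \<notin> corners n \<longrightarrow> word n w (p, d) = (p, d))"
    if pd: "(p, d) \<in> facelets n" for p d
  proof (cases "p \<in> corners n")
    case True
    then obtain i where i: "i < 8" "p = corner_at n i"
      using corner_at_bij[OF assms(1)] by (auto simp: bij_betw_def)
    \<comment> \<open>At a corner \<open>sides\<close> yields the path vector, of which the position
      is a multiple.\<close>
    then have "drag w (sides n p) p = p"
      by (simp add: corner_at_signs[OF assms(1)])
        (simp add: corner_at_def drag_scale drag_twisters_corner[OF assms(2)])
    with True show ?thesis
      by (simp add: word_apply[OF assms(1) pd])
  next
    case False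
    obtain x y z where p: "p = (x, y, z)"
      by (cases p)
    have *: "side n u \<in> {-1, 0, 1}" "side n u = 0 \<longleftrightarrow> u \<notin> {int n - 1, 1 - int n}" for u
      by (auto simp: side_def)
    have "side n x = 0 \<or> side n y = 0 \<or> side n z = 0"
      using False unfolding p corners_def *(2) by blast
    then have "drag w (sides n p) v = v" for v
      unfolding p sides.simps by (intro drag_twisters_noncorner assms *(1))
    then show ?thesis
      by (simp add: word_apply[OF assms(1) pd])
  qed
  then show ?thesis
    using word_in_rubik_group[OF assms(1)] corner_iff_corners[OF assms(1)]
    by (auto simp: corner_orientations_def)
qed

lemma twist_twister:
  assumes "n \<ge> 2" "j \<le> k" "k < 7"
  shows "twist (word n (twisters ! k)) (corner_at n j) = (if j = k then 1 else 0)"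
proof -
  have j: "j < 8"
    using assms by simp
  then have p: "corner_at n j \<in> corners n"
    using assms(1) by (intro corner_at_in_corners)
  have fix_pos: "drag (twisters ! k) (corner_path ! j) (corner_at n j) = corner_at n j"
  proof -
    have "twisters ! k \<in> set twisters"
      using assms(3) by (intro nth_mem) (simp add: twisters_def)
    then show ?thesis
      using j by (simp add: corner_at_def drag_scale drag_twisters_corner)
  qed
  have "(corner_at n j, (fst (corner_path ! j), 0, 0)) \<in> facelets n"
    using reference_facelet[OF assms(1) p] by (simp only: corner_at_signs[OF assms(1) j])
  from word_apply[OF assms(1) this] show ?thesis
    unfolding twist_def orient_def corner_at_signs[OF assms(1) j]
    by (simp only: fix_pos fst_conv snd_conv corner_at_signs[OF assms(1) j]
        drag_twisters_orient[OF assms(2,3)])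
qed

section \<open>Realising arbitrary twists at seven corners\<close>

text \<open>The witness is the \<open>m\<close>-th power of the \<open>k\<close>-th twister, built
  one factor at a time.\<close>

lemma exists_twist_at:
  assumes "n \<ge> 2" "k < 7"
  shows "\<exists>h \<in> corner_orientations n. \<forall>j \<le> k.
    twist h (corner_at n j) = (if j = k then int m mod 3 else 0)"
proof (induction m)
  case 0
  interpret subgroup "corner_orientations n" "rubik_group n"
    by (rule subgroup_corner_orientations)
  have "twist \<one>\<^bsub>rubik_group n\<^esub> (corner_at n j) = 0" if "j \<le> k" for j
    using reference_facelet[OF assms(1) corner_at_in_corners[OF assms(1)], of j] that assms(2)
    by (simp add: twist_def rubik_group_def BijGroup_def orient_def)
  then show ?case
    by (intro bexI[of _ "\<one>\<^bsub>rubik_group n\<^esub>"]) simp_all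
next
  case (Suc m)
  interpret subgroup "corner_orientations n" "rubik_group n"
    by (rule subgroup_corner_orientations)
  obtain h where h: "h \<in> corner_orientations n"
      "\<And>j. j \<le> k \<Longrightarrow> twist h (corner_at n j) = (if j = k then int m mod 3 else 0)"
    using Suc.IH by blast
  let ?w = "word n (twisters ! k)"
  have w: "?w \<in> corner_orientations n"
    using assms by (intro twister_in_corner_orientations nth_mem) (simp_all add: twisters_def)
  have "twist (?w \<otimes>\<^bsub>rubik_group n\<^esub> h) (corner_at n j) = (if j = k then int (Suc m) mod 3 else 0)"
    if "j \<le> k" for j
    using twist_mult[OF assms(1) w h(1) corner_at_in_corners[OF assms(1)], of j] that assms
    by (simp add: h(2) twist_twister mod_add_right_eq)
  then show ?case
    using w h(1) by (intro bexI[of _ "?w \<otimes>\<^bsub>rubik_group n\<^esub> h"]) simp_all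
qed

text \<open>Corners are corrected in path order: the factor for corner \<open>k\<close> leaves the
  earlier ones alone, and what it does to later ones is repaired afterwards.\<close>

lemma exists_twists:
  assumes "n \<ge> 2" "k \<le> 7" "\<And>i. i < 7 \<Longrightarrow> v i \<in> {0..<3 :: int}"
  shows "\<exists>g \<in> corner_orientations n. \<forall>j < k. twist g (corner_at n j) = v j"
  using assms(2)
proof (induction k)
  case 0
  then show ?case
    using subgroup.one_closed[OF subgroup_corner_orientations] by blast
next
  case (Suc k)
  interpret subgroup "corner_orientations n" "rubik_group n"
    by (rule subgroup_corner_orientations)
  obtain g where g: "g \<in> corner_orientations n" "\<And>j. j < k \<Longrightarrow> twist g (corner_at n j) = v j"
    using Suc by auto
  \<comment> \<open>The twist still missing at corner \<open>k\<close>, as a natural number so that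
    it can serve as an exponent.\<close>
  define m where "m = nat ((v k - twist g (corner_at n k)) mod 3)"
  obtain h where h: "h \<in> corner_orientations n"
      "\<And>j. j \<le> k \<Longrightarrow> twist h (corner_at n j) = (if j = k then int m mod 3 else 0)"
    using exists_twist_at[OF assms(1), of k m] Suc.prems by auto
  have "twist (g \<otimes>\<^bsub>rubik_group n\<^esub> h) (corner_at n j) = v j" if "j < Suc k" for j
  proof -
    have "twist (g \<otimes>\<^bsub>rubik_group n\<^esub> h) (corner_at n j) =
        (twist g (corner_at n j) + twist h (corner_at n j)) mod 3"
      using that Suc.prems by (intro twist_mult assms(1) g(1) h(1) corner_at_in_corners) simp_all
    also have "\<dots> = v j mod 3"
    proof (cases "j = k")
      case True
      then show ?thesis
        by (simp add: h(2) m_def mod_add_right_eq)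
    next
      case False
      then show ?thesis
        using that by (simp add: g(2) h(2))
    qed
    also have "\<dots> = v j"
      using assms(3)[of j] that Suc.prems by simp
    finally show ?thesis .
  qed
  then show ?case
    using g(1) h(1) by (intro bexI[of _ "g \<otimes>\<^bsub>rubik_group n\<^esub> h"]) simp_all
qed

section \<open>The isomorphism given by the twists at seven corners\<close>

theorem theorem15:
  fixes n :: nat
  assumes "n \<ge> 2"
  shows "(rubik_group n)\<lparr>carrier := corner_orientations n\<rparr>
           \<cong> product_group {..<7::nat} (\<lambda>_. integer_mod_group 3)"
proof (intro is_isoI isoI)
  let ?G = "(rubik_group n)\<lparr>carrier := corner_orientations n\<rparr>"
  let ?H = "product_group {..<7::nat} (\<lambda>_. integer_mod_group 3)"
  \<comment> \<open>The first seven corners of the path supply the coordinates; restriction is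
    needed because elements of the product are extensional functions.\<close>
  define \<phi> where "\<phi> g = (\<lambda>i \<in> {..<7}. twist g (corner_at n i))" for g
  have mod_carrier: "carrier (integer_mod_group 3) = {0..<3}"
    by (simp add: carrier_integer_mod_group)
  have range: "twist g p \<in> {0..<3}" for g p
    by (simp add: twist_def)
  have maps: "\<phi> g \<in> carrier ?H" for g
    using range by (auto simp: \<phi>_def mod_carrier)
  show "\<phi> \<in> hom ?G ?H"
  proof (rule homI)
    fix g h assume "g \<in> carrier ?G" "h \<in> carrier ?G"
    then show "\<phi> (g \<otimes>\<^bsub>?G\<^esub> h) = \<phi> g \<otimes>\<^bsub>?H\<^esub> \<phi> h"
      using assms by (auto simp: \<phi>_def mult_integer_mod_group twist_mult corner_at_in_corners
          intro!: restrict_ext)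
  qed (rule maps)
  show "bij_betw \<phi> (carrier ?G) (carrier ?H)"
    unfolding bij_betw_def
  proof
    show "inj_on \<phi> (carrier ?G)"
    proof (rule inj_onI)
      fix g h assume g: "g \<in> carrier ?G" and h: "h \<in> carrier ?G" and "\<phi> g = \<phi> h"
      have eq: "twist g (corner_at n i) = twist h (corner_at n i)" if "i < 7" for i
        using fun_cong[OF \<open>\<phi> g = \<phi> h\<close>, of i] that by (simp add: \<phi>_def)
      \<comment> \<open>The total twist vanishes modulo 3, so the twist at the last corner is
        determined by the other seven.\<close>
      have sum: "3 dvd (\<Sum>i<7. twist f (corner_at n i)) + twist f (corner_at n 7)"
        if f: "f \<in> carrier ?G" for f
      proof -
        obtain \<sigma> where "twisted n f \<sigma> (twist f)"
          using corner_orientations_twisted[OF assms, of f] f by auto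
        then have "3 dvd (\<Sum>p \<in> corners n. twist f p)"
          by (simp add: twisted_def)
        also have "(\<Sum>p \<in> corners n. twist f p) = (\<Sum>i<8. twist f (corner_at n i))"
          by (rule sum.reindex_bij_betw[OF corner_at_bij[OF assms], symmetric])
        also have "\<dots> = (\<Sum>i<7. twist f (corner_at n i)) + twist f (corner_at n 7)"
          using sum.lessThan_Suc[of "\<lambda>i. twist f (corner_at n i)" 7] by simp
        finally show ?thesis .
      qed
      have "(\<Sum>i<7. twist g (corner_at n i)) = (\<Sum>i<7. twist h (corner_at n i))"
        using eq by (intro sum.cong) simp_all
      then have "3 dvd twist g (corner_at n 7) - twist h (corner_at n 7)"
        using dvd_diff[OF sum[OF g] sum[OF h]] by simp
      then have "twist g (corner_at n 7) mod 3 = twist h (corner_at n 7) mod 3"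
        by (simp add: mod_eq_dvd_iff)
      \<comment> \<open>Values of \<open>twist\<close> are already reduced, so congruence is
        equality.\<close>
      then have eq7: "twist g (corner_at n 7) = twist h (corner_at n 7)"
        by (simp add: twist_def)
      have "twist g (corner_at n i) = twist h (corner_at n i)" if "i < 8" for i
        using eq[of i] eq7 that by (cases "i = 7") simp_all
      then have "twist g p = twist h p" if "p \<in> corners n" for p
        using bij_betw_imp_surj_on[OF corner_at_bij[OF assms]] that by (metis imageE lessThan_iff)
      with g h show "g = h"
        using corner_orientations_eqI[OF assms] by simp
    qed
    show "\<phi> ` carrier ?G = carrier ?H"
    proof
      show "\<phi> ` carrier ?G \<subseteq> carrier ?H"
        using maps by blast
      show "carrier ?H \<subseteq> \<phi> ` carrier ?G"
      proof
        fix v assume "v \<in> carrier ?H"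
        then have v: "v \<in> {..<7} \<rightarrow>\<^sub>E {0..<3}"
          by (simp add: mod_carrier)
        have "v i \<in> {0..<3}" if "i < 7" for i
          using PiE_mem[OF v, of i] that by simp
        then obtain g where g: "g \<in> corner_orientations n"
            "\<And>j. j < 7 \<Longrightarrow> twist g (corner_at n j) = v j"
          using exists_twists[OF assms, of 7 v] by blast
        have "\<phi> g = restrict v {..<7}"
          unfolding \<phi>_def using g(2) by (intro restrict_ext) simp
        then have "\<phi> g = v"
          using PiE_restrict[OF v] by simp
        with g(1) show "v \<in> \<phi> ` carrier ?G"
          by auto
      qed
    qed
  qed
qed

end
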